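(* For the infinite square grid $G_{\square}$, the surviving rate for one firefighter satisfies $\rho(G_{\square})=1/4$.
   Context: $G_{\square}$ is the graph with vertex set $\mathbb{Z}^2$ in which two vertices are adjacent if and only if they are at Euclidean distance $1$; it is vertex-transitive. Firefighter problem: a fire breaks out at a vertex $v$ (at time $0$). In each subsequent turn $1,2,3,\dots$, the firefighter first protects one vertex which is not yet on fire, and then the fire spreads to all unprotected neighbors of the vertices already on fire. Once a vertex is on fire or is protected it stays in that state forever. Surviving rate for infinite graphs: let $G$ be an infinite graph with all degrees finite, and let $N_{\le i}(v)$ be the set of vertices at graph distance at most $i$ from $v$. For a fixed deterministic strategy $\mathcal F$ of the firefighter for the fire starting at $v$, let $S=S(\mathcal F)$ be the set of saved vertices, i.e. vertices that never catch fire. Put $$\rho_{\mathcal F}(G,v)=\liminf_{i\to\infty}\frac{|N_{\le i}(v)\cap S|}{|N_{\le i}(v)|},\qquad \rho(G,v)=\sup_{\mathcal F}\rho_{\mathcal F}(G,v).$$ If $G$ is vertex-transitive, $\rho(G,v)$ does not depend on $v$ and is denoted $\rho(G)$. *)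

theory Defs
  imports "HOL-Analysis.Analysis"
begin

text \<open>
  A graph is given by its symmetric irreflexive adjacency relation \<open>E\<close>; its vertex set is the
  whole type \<open>'a\<close>.
\<close>

definition graph_dist :: "('a \<times> 'a) set \<Rightarrow> 'a \<Rightarrow> 'a \<Rightarrow> enat" where
  "graph_dist E u w = (INF k \<in> {k. (u, w) \<in> E ^^ k}. enat k)"

definition nbhd :: "('a \<times> 'a) set \<Rightarrow> nat \<Rightarrow> 'a \<Rightarrow> 'a set" where
  "nbhd E i v = {w. graph_dist E v w \<le> enat i}"

text \<open>
  The fire spreads deterministically, so a deterministic strategy for a fire starting at a given
  vertex amounts to the sequence \<open>p\<close> of its moves: \<open>p t\<close> is the vertex protected in turn
  \<open>t \<ge> 1\<close>, and the value \<open>p 0\<close> plays no role.  \<open>burning E v p t\<close> is the set of vertices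
  on fire at the end of turn \<open>t\<close>.
\<close>

primrec burning :: "('a \<times> 'a) set \<Rightarrow> 'a \<Rightarrow> (nat \<Rightarrow> 'a) \<Rightarrow> nat \<Rightarrow> 'a set" where
  "burning E v p 0 = {v}"
| "burning E v p (Suc t) = burning E v p t \<union> (E `` burning E v p t - p ` {1..Suc t})"

text \<open>
  The only constraint on a move is that the vertex is not yet on fire; choosing a vertex that is
  already protected is a permitted move without effect.
\<close>

definition strategies :: "('a \<times> 'a) set \<Rightarrow> 'a \<Rightarrow> (nat \<Rightarrow> 'a) set" where
  "strategies E v = {p. \<forall>t. p (Suc t) \<notin> burning E v p t}"

definition saved :: "('a \<times> 'a) set \<Rightarrow> 'a \<Rightarrow> (nat \<Rightarrow> 'a) \<Rightarrow> 'a set" where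
  "saved E v p = - (\<Union>t. burning E v p t)"

definition strategy_rate :: "('a \<times> 'a) set \<Rightarrow> 'a \<Rightarrow> (nat \<Rightarrow> 'a) \<Rightarrow> ereal" where
  "strategy_rate E v p =
     liminf (\<lambda>i. ereal (real (card (nbhd E i v \<inter> saved E v p)) / real (card (nbhd E i v))))"

definition surviving_rate :: "('a \<times> 'a) set \<Rightarrow> 'a \<Rightarrow> ereal" where
  "surviving_rate E v = (SUP p \<in> strategies E v. strategy_rate E v p)"

text \<open>The distance on \<^typ>\<open>real \<times> real\<close> is the Euclidean one.\<close>

definition square_grid :: "((int \<times> int) \<times> (int \<times> int)) set" where
  "square_grid = {((a, b), (c, d)).
     dist (real_of_int a, real_of_int b) (real_of_int c, real_of_int d) = 1}"

end

theory Submission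
  imports Defs "HOL-Real_Asymp.Real_Asymp"
begin

text \<open>
  Distances are \<open>\<ell>\<^sub>1\<close> distances from the origin \<open>v\<close> of the fire, and the sphere of radius
  \<open>k \<ge> 1\<close> has \<open>4k\<close> vertices. The number 1/4 comes from comparing this growth, 4 vertices
  per turn, with the single vertex that the firefighter can take away per turn.

  Upper bound. Let the front \<open>B\<^sub>k\<close> be the set of vertices at distance exactly \<open>k\<close> that burn at time \<open>k\<close>,
  the earliest time possible. On the part of a sphere in a closed quadrant, which is
  a path, a nonempty set has at least one more outward neighbour than it has elements
  (\<open>card_shift\<close>). Hence in each closed quadrant \<open>B\<^sub>k\<close> plus the vertices protected so far number at
  least \<open>k + 1\<close>, so that \<open>B\<^sub>k\<close> meets all four closed quadrants forever (\<open>front_quadrant\<close>).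
  The gain of one also holds if, in a nonempty closed quadrant, only the vertices off one of the two
  bounding axes are counted. The half-open quadrants obtained this way are disjoint, so the gains add up
  to 4 (\<open>outward_growth_total\<close>), and at most \<open>k\<close> of them are lost to protected vertices up to time
  \<open>k\<close>. Therefore \<open>\<bar>B\<^sub>k\<bar> \<ge> 3k\<close> for all \<open>k \<ge> 1\<close> (\<open>card_front\<close>): three quarters of every sphere burn.

  Lower bound. Protecting \<open>(1,0), (1,1), (2,-1), (2,2), (3,-2), \<dots>\<close> in turns \<open>1, 2, 3, \<dots>\<close> builds
  two diagonal walls. The vertex protected in turn \<open>t\<close> is at distance \<open>t\<close>, so the fire never
  gets ahead, and the sector \<open>-x < y \<le> x\<close> behind the walls is saved (\<open>sector_saved\<close>). Its images under
  the four rotations by multiples of a quarter turn partition the grid without \<open>v\<close>, so it contains a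
  quarter of every ball except for the centre (\<open>card_ball_fundamental\<close>).
\<close>


section \<open>The grid metric\<close>

definition l1 :: "int \<times> int \<Rightarrow> int \<times> int \<Rightarrow> nat" where
  "l1 z w = nat (\<bar>fst w - fst z\<bar> + \<bar>snd w - snd z\<bar>)"

lemma square_grid_iff: "(z, w) \<in> square_grid \<longleftrightarrow> l1 z w = 1"
proof -
  obtain a b c d where z: "z = (a, b)" and w: "w = (c, d)"
    by fastforce
  have "(z, w) \<in> square_grid \<longleftrightarrow> (real_of_int a - real_of_int c)\<^sup>2 + (real_of_int b - real_of_int d)\<^sup>2 = 1"
    by (simp add: square_grid_def z w dist_prod_def dist_real_def)
  also have "\<dots> \<longleftrightarrow> real_of_int ((a - c)\<^sup>2 + (b - d)\<^sup>2) = real_of_int 1"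
    by simp
  also have "\<dots> \<longleftrightarrow> (a - c)\<^sup>2 + (b - d)\<^sup>2 = 1"
    by (simp only: of_int_eq_iff)
  also have "\<dots> \<longleftrightarrow> \<bar>a - c\<bar> + \<bar>b - d\<bar> = 1"
  proof
    assume sq: "(a - c)\<^sup>2 + (b - d)\<^sup>2 = 1"
    have le1: "\<bar>x\<bar> \<le> 1" if "x\<^sup>2 \<le> 1" for x :: int
      using that by (simp add: abs_square_le_1)
    have "(a - c)\<^sup>2 \<le> 1" "(b - d)\<^sup>2 \<le> 1"
      using sq zero_le_power2[of "a - c"] zero_le_power2[of "b - d"] by linarith+
    then have "\<bar>a - c\<bar> \<le> 1" "\<bar>b - d\<bar> \<le> 1"
      by (auto intro: le1)
    then have "a - c \<in> {-1, 0, 1}" "b - d \<in> {-1, 0, 1}"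
      by auto
    then show "\<bar>a - c\<bar> + \<bar>b - d\<bar> = 1"
      using sq by auto
  next
    assume "\<bar>a - c\<bar> + \<bar>b - d\<bar> = 1"
    then have "(a - c = 0 \<and> (b - d = 1 \<or> b - d = -1)) \<or> (b - d = 0 \<and> (a - c = 1 \<or> a - c = -1))"
      by linarith
    then show "(a - c)\<^sup>2 + (b - d)\<^sup>2 = 1"
      by auto
  qed
  also have "\<dots> \<longleftrightarrow> l1 z w = 1"
    by (auto simp: l1_def z w)
  finally show ?thesis .
qed

lemma l1_triangle: "l1 x z \<le> l1 x y + l1 y z"
  by (simp add: l1_def)

lemma l1_le_if_relpow:
  assumes "(z, w) \<in> square_grid ^^ k"
  shows "l1 z w \<le> k"
  using assms
proof (induction k arbitrary: w)
  case 0
  then show ?case by (simp add: l1_def)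
next
  case (Suc k)
  then obtain y where "l1 z y \<le> k" "l1 y w = 1"
    unfolding relpow.simps square_grid_iff[symmetric] by blast
  then show ?case
    using l1_triangle[of z w y] by linarith
qed

lemma relpow_l1: "(z, w) \<in> square_grid ^^ l1 z w"
proof (induction "l1 z w" arbitrary: w)
  case 0
  then have "w = z"
    unfolding l1_def prod_eq_iff by linarith
  then show ?case
    using 0 by simp
next
  case (Suc n)
  \<comment> \<open>the last step of a shortest path changes a coordinate in which the ends differ\<close>
  define y where
    "y = (if fst w \<noteq> fst z then (fst w - sgn (fst w - fst z), snd w)
          else (fst w, snd w - sgn (snd w - snd z)))"
  have "l1 z y = n" "l1 y w = 1"
    using Suc.hyps(2) by (auto simp: y_def l1_def sgn_if split: if_splits)
  then show ?case
    using Suc.hyps(1)[of y] Suc.hyps(2) by (metis relpow_Suc_I square_grid_iff)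
qed

lemma graph_dist_square_grid: "graph_dist square_grid z w = enat (l1 z w)"
  unfolding graph_dist_def
proof (rule antisym)
  show "(INF k\<in>{k. (z, w) \<in> square_grid ^^ k}. enat k) \<le> enat (l1 z w)"
    by (rule INF_lower) (simp add: relpow_l1)
  show "enat (l1 z w) \<le> (INF k\<in>{k. (z, w) \<in> square_grid ^^ k}. enat k)"
    by (rule INF_greatest) (simp add: l1_le_if_relpow)
qed

lemma nbhd_square_grid: "nbhd square_grid i v = {w. l1 v w \<le> i}"
  by (simp add: nbhd_def graph_dist_square_grid)

lemma finite_nbhd: "finite {w. l1 v w \<le> i}"
proof (rule finite_subset)
  show "{w. l1 v w \<le> i} \<subseteq> {fst v - int i..fst v + int i} \<times> {snd v - int i..snd v + int i}"
    by (auto simp: l1_def)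
qed simp


section \<open>Quarter turns\<close>

text \<open>The unit vectors stand for the four rotations by multiples of a quarter turn: in complex notation,
  \<open>frame v u z\<close> is \<open>v + u z\<close>.\<close>

definition dirs :: "(int \<times> int) set" where
  "dirs = {(1, 0), (0, 1), (-1, 0), (0, -1)}"

definition frame :: "int \<times> int \<Rightarrow> int \<times> int \<Rightarrow> int \<times> int \<Rightarrow> int \<times> int" where
  "frame v u z = (fst v + fst z * fst u - snd z * snd u, snd v + fst z * snd u + snd z * fst u)"

lemma card_dirs: "card dirs = 4" and finite_dirs: "finite dirs"
  by (simp_all add: dirs_def)

lemma inj_frame: "u \<in> dirs \<Longrightarrow> inj (frame v u)"
  by (auto simp: inj_def frame_def dirs_def)

lemma frame_eq_iff: "u \<in> dirs \<Longrightarrow> frame v u z = frame v u w \<longleftrightarrow> z = w"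
  using inj_frame by (simp add: inj_eq)

lemma l1_frame: "u \<in> dirs \<Longrightarrow> l1 (frame v u z) (frame v u w) = l1 z w"
  by (auto simp: l1_def frame_def dirs_def)

lemma frame_0: "frame v u (0, 0) = v"
  by (simp add: frame_def)

lemma l1_coords: "l1 (0, 0) (x, y) = nat (\<bar>x\<bar> + \<bar>y\<bar>)"
  by (simp add: l1_def)

lemma l1_frame_center: "u \<in> dirs \<Longrightarrow> l1 v (frame v u w) = l1 (0, 0) w"
  using l1_frame[of u v "(0, 0)" w] by (simp add: frame_0)

text \<open>Fundamental domains of the rotations about \<open>v\<close>, which act freely away from \<open>v\<close>.\<close>

definition fundamental :: "(int \<times> int) set \<Rightarrow> bool" where
  "fundamental C \<longleftrightarrow> (\<forall>v. (\<Union>u\<in>dirs. frame v u ` C) = - {v}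
     \<and> disjoint_family_on (\<lambda>u. frame v u ` C) dirs)"

lemma fundamental_cover: "fundamental C \<Longrightarrow> (\<Union>u\<in>dirs. frame v u ` C) = - {v}"
  and fundamental_disjoint: "fundamental C \<Longrightarrow> disjoint_family_on (\<lambda>u. frame v u ` C) dirs"
  unfolding fundamental_def by blast+

text \<open>The four conditions are membership of the point \<open>(x, y)\<close> in the four rotated copies of \<open>C\<close>,
  each pulled back to \<open>C\<close>, which turns the partition property into linear arithmetic.\<close>

lemma fundamentalI:
  assumes "\<And>x y. (x, y) \<in> C \<longleftrightarrow> P x y"
    and "\<And>x y. x \<noteq> 0 \<or> y \<noteq> 0 \<longleftrightarrow> P x y \<or> P y (-x) \<or> P (-x) (-y) \<or> P (-y) x"
    and "\<And>x y. P x y \<Longrightarrow> \<not> P y (-x) \<and> \<not> P (-x) (-y) \<and> \<not> P (-y) x"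
  shows "fundamental C"
proof -
  have mem: "w \<in> frame v u ` C \<longleftrightarrow>
      (let x = fst w - fst v; y = snd w - snd v in P (x * fst u + y * snd u) (y * fst u - x * snd u))"
    if "u \<in> dirs" for u v w
  proof -
    obtain x y where w: "w = (fst v + x, snd v + y)"
      by (metis add.commute diff_add_cancel prod.collapse)
    have "w = frame v u (x * fst u + y * snd u, y * fst u - x * snd u)"
      using that by (auto simp: dirs_def frame_def w)
    then have "w \<in> frame v u ` C \<longleftrightarrow> (x * fst u + y * snd u, y * fst u - x * snd u) \<in> C"
      using inj_frame[OF that] by (simp add: inj_image_mem_iff)
    then show ?thesis
      by (simp add: assms(1) w)
  qed
  have "w \<in> (\<Union>u\<in>dirs. frame v u ` C) \<longleftrightarrow> w \<noteq> v" for v w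
  proof -
    have "w \<in> (\<Union>u\<in>dirs. frame v u ` C) \<longleftrightarrow> (\<exists>u\<in>dirs. w \<in> frame v u ` C)"
      by blast
    also have "\<dots> \<longleftrightarrow> fst w - fst v \<noteq> 0 \<or> snd w - snd v \<noteq> 0"
      by (subst assms(2)) (auto simp: mem Let_def dirs_def simp del: minus_diff_eq)
    also have "\<dots> \<longleftrightarrow> w \<noteq> v"
      by (simp add: prod_eq_iff)
    finally show ?thesis .
  qed
  moreover have "disjoint_family_on (\<lambda>u. frame v u ` C) dirs" for v
  proof -
    have "u = u'" if u: "u \<in> dirs" "u' \<in> dirs" "w \<in> frame v u ` C" "w \<in> frame v u' ` C" for u u' w
    proof -
      define x y where "x = fst w - fst v" and "y = snd w - snd v"
      have "P (x * fst u + y * snd u) (y * fst u - x * snd u)"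
        "P (x * fst u' + y * snd u') (y * fst u' - x * snd u')"
        using u by (simp_all add: mem x_def y_def Let_def)
      then show ?thesis
        using u(1,2) unfolding dirs_def
        by (elim insertE emptyE; hypsubst)
          (use assms(3)[of x y] assms(3)[of y "-x"] assms(3)[of "-x" "-y"] in simp_all)
    qed
    then show ?thesis
      unfolding disjoint_family_on_def by blast
  qed
  ultimately show ?thesis
    unfolding fundamental_def set_eq_iff by blast
qed

text \<open>Two fundamental domains are needed: the half-open quadrant is suited to counting spheres and to the growth
  of the fire, and the sector between the diagonals is what a good strategy saves.\<close>

definition half_quadrant :: "(int \<times> int) set" where
  "half_quadrant = {(x, y). 0 < x \<and> 0 \<le> y}"

definition sector :: "(int \<times> int) set" where
  "sector = {(x, y). - x < y \<and> y \<le> x}"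

lemma fundamental_half_quadrant: "fundamental half_quadrant"
  by (rule fundamentalI[where P = "\<lambda>x y. 0 < x \<and> 0 \<le> y"]) (auto simp: half_quadrant_def)

lemma fundamental_sector: "fundamental sector"
  by (rule fundamentalI[where P = "\<lambda>x y. - x < y \<and> y \<le> x"]) (auto simp: sector_def)

lemma card_fundamental_split:
  assumes "fundamental C" "finite X" "v \<notin> X"
  shows "card X = (\<Sum>u\<in>dirs. card (X \<inter> frame v u ` C))"
proof -
  have "X = (\<Union>u\<in>dirs. X \<inter> frame v u ` C)"
    using fundamental_cover[OF assms(1), of v] assms(3) by auto
  then have "card X = card (\<Union>u\<in>dirs. X \<inter> frame v u ` C)"
    by (rule arg_cong[where f = card])
  also have "\<dots> = (\<Sum>u\<in>dirs. card (X \<inter> frame v u ` C))"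
  proof (rule card_UN_disjoint[OF finite_dirs])
    show "\<forall>u\<in>dirs. \<forall>u'\<in>dirs. u \<noteq> u' \<longrightarrow>
        (X \<inter> frame v u ` C) \<inter> (X \<inter> frame v u' ` C) = {}"
      using fundamental_disjoint[OF assms(1), of v] unfolding disjoint_family_on_def by blast
  qed (simp add: assms(2))
  finally show ?thesis .
qed

lemma card_ball_fundamental:
  assumes "fundamental C" "u \<in> dirs"
  shows "card {w. l1 v w \<le> i} = 1 + 4 * card ({w. l1 v w \<le> i} \<inter> frame v u ` C)"
proof -
  let ?B = "{w. l1 v w \<le> i}"
  have *: "card ((?B - {v}) \<inter> frame v u' ` C) = card (C \<inter> {z. l1 (0, 0) z \<le> i})"
    if "u' \<in> dirs" for u'
  proof -
    have "v \<notin> frame v u' ` C"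
      using fundamental_cover[OF assms(1), of v] that by blast
    then have "(?B - {v}) \<inter> frame v u' ` C = frame v u' ` (C \<inter> {z. l1 (0, 0) z \<le> i})"
      using that by (auto simp: l1_frame_center)
    then show ?thesis
      using inj_frame[OF that] by (metis card_image inj_on_subset subset_UNIV)
  qed
  have "card ?B = 1 + card (?B - {v})"
    using finite_nbhd[of v i] by (subst card.remove[of _ v]) (auto simp: l1_def)
  also have "card (?B - {v}) = (\<Sum>u\<in>dirs. card ((?B - {v}) \<inter> frame v u ` C))"
    using assms(1) finite_nbhd by (intro card_fundamental_split) auto
  also have "\<dots> = 4 * card ((?B - {v}) \<inter> frame v u ` C)"
    using * assms(2) by (simp add: card_dirs)
  also have "(?B - {v}) \<inter> frame v u ` C = ?B \<inter> frame v u ` C"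
    using fundamental_cover[OF assms(1), of v] assms(2) by blast
  finally show ?thesis .
qed

text \<open>The sphere of radius \<open>k\<close> contributes the \<open>k\<close> points \<open>(a, k - a)\<close> with \<open>1 \<le> a \<le> k\<close>.\<close>

lemma card_ball_half_quadrant:
  assumes "u \<in> dirs"
  shows "card ({w. l1 v w \<le> i} \<inter> frame v u ` half_quadrant) = \<Sum>{..i}"
proof -
  let ?f = "\<lambda>(k, a). frame v u (int a, int k - int a)"
  have "{w. l1 v w \<le> i} \<inter> frame v u ` half_quadrant = ?f ` (SIGMA k:{..i}. {1..k})"
  proof (intro equalityI subsetI)
    fix w assume "w \<in> {w. l1 v w \<le> i} \<inter> frame v u ` half_quadrant"
    then obtain x y where w: "w = frame v u (x, y)" "0 < x" "0 \<le> y" and "l1 v w \<le> i"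
      unfolding half_quadrant_def by blast
    then have "l1 (0, 0) (x, y) \<le> i"
      using l1_frame_center[OF assms] by metis
    then have "x + y \<le> int i"
      using w by (simp add: l1_coords)
    then have "w = ?f (nat (x + y), nat x)" "(nat (x + y), nat x) \<in> (SIGMA k:{..i}. {1..k})"
      using w by auto
    then show "w \<in> ?f ` (SIGMA k:{..i}. {1..k})"
      by (rule image_eqI)
  next
    fix w assume "w \<in> ?f ` (SIGMA k:{..i}. {1..k})"
    then show "w \<in> {w. l1 v w \<le> i} \<inter> frame v u ` half_quadrant"
      by (auto simp: half_quadrant_def l1_frame_center[OF assms] l1_coords)
  qed
  moreover have "inj_on ?f (SIGMA k:{..i}. {1..k})"
    by (auto simp: inj_on_def frame_eq_iff[OF assms])
  ultimately show ?thesis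
    by (simp add: card_image)
qed

lemma card_ball: "card {w. l1 v w \<le> i} = 1 + 4 * \<Sum>{..i}"
  using card_ball_fundamental[OF fundamental_half_quadrant, of "(1, 0)" v i]
  by (simp add: card_ball_half_quadrant dirs_def)


section \<open>Growth of the fire front\<close>

definition quadrant :: "(int \<times> int) set" where
  "quadrant = {(x, y). 0 \<le> x \<and> 0 \<le> y}"

text \<open>
  The sphere of radius \<open>k\<close> in a closed quadrant is the path \<open>{0..k}\<close>, with \<open>a\<close> standing for \<open>(a, k - a)\<close>,
  and the outward neighbours of \<open>a\<close> are \<open>a\<close> and \<open>Suc a\<close> on the next sphere. The shifted copy of
  \<open>A\<close> misses \<open>Min A\<close>, which gives the first gain. For the second, removing the axis
  point 0 costs nothing new: either 0 is in \<open>A\<close>, and then \<open>Suc ` A\<close> alone is as large as \<open>A\<close>, or it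
  is not, and then it is in neither set.
\<close>

lemma card_shift:
  fixes A :: "nat set"
  assumes "finite A" "A \<noteq> {}"
  shows "card A < card (A \<union> Suc ` A)"
    and "card (A - {0}) < card ((A \<union> Suc ` A) - {0})"
proof -
  have "Min A \<notin> Suc ` A"
    using assms by (auto dest: Min_le)
  then have "A \<union> Suc ` A \<supseteq> insert (Min A) (Suc ` A)" "card (insert (Min A) (Suc ` A)) = Suc (card A)"
    using assms by (auto simp: card_image)
  then show *: "card A < card (A \<union> Suc ` A)"
    using assms by (metis Suc_le_eq card_mono finite_UnI finite_imageI)
  show "card (A - {0}) < card ((A \<union> Suc ` A) - {0})"
  proof (cases "0 \<in> A")
    case True
    have "card (A - {0}) < card A"
      using True assms by (simp add: card_gt_0_iff)
    also have "\<dots> = card (Suc ` A)"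
      by (simp add: card_image)
    also have "\<dots> \<le> card ((A \<union> Suc ` A) - {0})"
      using assms by (intro card_mono) auto
    finally show ?thesis .
  next
    case False
    then have "A - {0} = A" "(A \<union> Suc ` A) - {0} = A \<union> Suc ` A"
      by auto
    with * show ?thesis
      by simp
  qed
qed

definition outward :: "int \<times> int \<Rightarrow> nat \<Rightarrow> (int \<times> int) set \<Rightarrow> (int \<times> int) set" where
  "outward v k X = square_grid `` X \<inter> {w. l1 v w = Suc k}"

lemma finite_outward: "finite (outward v k X)"
  by (rule finite_subset[OF _ finite_nbhd[of v "Suc k"]]) (auto simp: outward_def)

text \<open>
  The growth in the half-open quadrant only needs that the closed quadrant is hit: a
  single vertex on the axis outside the half-open quadrant already has a neighbour inside it.
\<close>

lemma outward_growth:
  assumes "u \<in> dirs" "X \<subseteq> {w. l1 v w = k}" "X \<inter> frame v u ` quadrant \<noteq> {}"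
  shows "card (X \<inter> frame v u ` quadrant) < card (outward v k X \<inter> frame v u ` quadrant)"
    and "card (X \<inter> frame v u ` half_quadrant) < card (outward v k X \<inter> frame v u ` half_quadrant)"
proof -
  define pos where "pos k a = frame v u (int a, int k - int a)" for k a :: nat
  define A where "A = {a. a \<le> k \<and> pos k a \<in> X}"
  have inj: "inj_on (pos m) Y" for m Y
    by (auto simp: inj_on_def pos_def frame_eq_iff[OF assms(1)])
  have XQ: "X \<inter> frame v u ` quadrant = pos k ` A"
  proof (intro equalityI subsetI)
    fix w assume w: "w \<in> X \<inter> frame v u ` quadrant"
    then obtain x y where xy: "w = frame v u (x, y)" "0 \<le> x" "0 \<le> y"
      unfolding quadrant_def by blast
    moreover have "l1 v w = k"
      using w assms(2) by blast
    ultimately have "x + y = int k"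
      using xy by (auto simp: l1_frame_center[OF assms(1)] l1_coords)
    then have "w = pos k (nat x)" "nat x \<le> k"
      using xy by (auto simp: pos_def frame_eq_iff[OF assms(1)])
    then show "w \<in> pos k ` A"
      using w by (auto simp: A_def)
  qed (auto simp: A_def pos_def quadrant_def)
  have "A \<noteq> {}" "finite A"
    using assms(3) XQ by (auto simp: A_def)
  note shift = card_shift[OF this(2,1)]
  have full: "pos m a \<in> frame v u ` quadrant" if "a \<le> m" for m a
    using that by (auto simp: pos_def quadrant_def)
  have half: "pos m a \<in> frame v u ` half_quadrant \<longleftrightarrow> a \<noteq> 0" if "a \<le> m" for m a
    using that inj_frame[OF assms(1), of v] by (auto simp: pos_def inj_image_mem_iff half_quadrant_def)
  have XH: "X \<inter> frame v u ` half_quadrant = pos k ` (A - {0})"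
  proof -
    have "half_quadrant \<subseteq> quadrant"
      by (auto simp: half_quadrant_def quadrant_def)
    then have "X \<inter> frame v u ` half_quadrant = (X \<inter> frame v u ` quadrant) \<inter> frame v u ` half_quadrant"
      by auto
    also have "\<dots> = pos k ` {a \<in> A. pos k a \<in> frame v u ` half_quadrant}"
      unfolding XQ by blast
    also have "{a \<in> A. pos k a \<in> frame v u ` half_quadrant} = A - {0}"
      using half[of _ k] by (auto simp: A_def)
    finally show ?thesis .
  qed
  have adj: "pos (Suc k) b \<in> outward v k X" if "b \<in> A \<union> Suc ` A" for b
  proof -
    from that obtain a where a: "a \<in> A" "b = a \<or> b = Suc a"
      by auto
    then have "l1 (pos k a) (pos (Suc k) b) = 1"
      unfolding pos_def l1_frame[OF assms(1)] by (auto simp: l1_def)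
    moreover have "l1 v (pos (Suc k) b) = Suc k"
      using a by (auto simp: A_def pos_def l1_frame_center[OF assms(1)] l1_coords)
    ultimately show ?thesis
      using a by (auto simp: outward_def square_grid_iff A_def)
  qed
  have le: "b \<le> Suc k" if "b \<in> A \<union> Suc ` A" for b
    using that by (auto simp: A_def)
  have "card (X \<inter> frame v u ` quadrant) = card A"
    by (simp add: XQ card_image inj)
  also have "\<dots> < card (pos (Suc k) ` (A \<union> Suc ` A))"
    using shift(1) by (simp add: card_image inj)
  also have "\<dots> \<le> card (outward v k X \<inter> frame v u ` quadrant)"
    using adj le full[of _ "Suc k"] by (intro card_mono finite_Int disjI1 finite_outward) blast
  finally show "card (X \<inter> frame v u ` quadrant) < card (outward v k X \<inter> frame v u ` quadrant)" .
  have "card (X \<inter> frame v u ` half_quadrant) = card (A - {0})"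
    by (simp add: XH card_image inj)
  also have "\<dots> < card (pos (Suc k) ` ((A \<union> Suc ` A) - {0}))"
    using shift(2) by (simp add: card_image inj)
  also have "\<dots> \<le> card (outward v k X \<inter> frame v u ` half_quadrant)"
    using adj le half[of _ "Suc k"] by (intro card_mono finite_Int disjI1 finite_outward) blast
  finally show "card (X \<inter> frame v u ` half_quadrant) < card (outward v k X \<inter> frame v u ` half_quadrant)" .
qed

text \<open>
  The centre is removed since it lies in no half-open quadrant; this matters only for \<open>k = 0\<close>, where the four
  neighbours of \<open>v\<close> are the gain.
\<close>

lemma outward_growth_total:
  assumes "X \<subseteq> {w. l1 v w = k}" "\<And>u. u \<in> dirs \<Longrightarrow> X \<inter> frame v u ` quadrant \<noteq> {}"
  shows "card (X - {v}) + 4 \<le> card (outward v k X)"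
proof -
  have "finite X"
    by (rule finite_subset[OF _ finite_nbhd[of v k]]) (use assms(1) in auto)
  then have "card (X - {v}) = (\<Sum>u\<in>dirs. card ((X - {v}) \<inter> frame v u ` half_quadrant))"
    by (intro card_fundamental_split[OF fundamental_half_quadrant]) auto
  also have "\<dots> + 4 = (\<Sum>u\<in>dirs. Suc (card ((X - {v}) \<inter> frame v u ` half_quadrant)))"
    by (simp only: Suc_eq_plus1 sum.distrib) (simp add: card_dirs)
  also have "\<dots> \<le> (\<Sum>u\<in>dirs. card (outward v k X \<inter> frame v u ` half_quadrant))"
  proof (rule sum_mono)
    fix u assume u: "u \<in> dirs"
    have "card ((X - {v}) \<inter> frame v u ` half_quadrant) \<le> card (X \<inter> frame v u ` half_quadrant)"
      using \<open>finite X\<close> by (intro card_mono) auto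
    then show "Suc (card ((X - {v}) \<inter> frame v u ` half_quadrant))
        \<le> card (outward v k X \<inter> frame v u ` half_quadrant)"
      using outward_growth(2)[OF u assms(1) assms(2)[OF u]] by linarith
  qed
  also have "\<dots> = card (outward v k X)"
    by (intro card_fundamental_split[OF fundamental_half_quadrant, symmetric] finite_outward)
      (simp add: outward_def l1_def)
  finally show ?thesis .
qed


section \<open>Every strategy saves at most a quarter\<close>

text \<open>
  The front consists of the vertices that the fire reaches without delay. It neglects all vertices
  that the fire reaches later by a detour, so counting fronts gives a lower bound for the burnt area.
\<close>

definition front :: "int \<times> int \<Rightarrow> (nat \<Rightarrow> int \<times> int) \<Rightarrow> nat \<Rightarrow> (int \<times> int) set" where
  "front v p k = burning square_grid v p k \<inter> {w. l1 v w = k}"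

text \<open>
  Among the vertices protected up to turn \<open>k\<close>, only those within distance \<open>k\<close> can have hindered
  a front so far. With this restriction every vertex is charged to one sphere only, even if it
  is protected long before the fire gets there.
\<close>

definition guards :: "int \<times> int \<Rightarrow> (nat \<Rightarrow> int \<times> int) \<Rightarrow> nat \<Rightarrow> (int \<times> int) set" where
  "guards v p k = p ` {1..k} \<inter> {w. l1 v w \<le> k}"

lemma finite_front: "finite (front v p k)"
  by (rule finite_subset[OF _ finite_nbhd[of v k]]) (auto simp: front_def)

lemma card_guards: "card (guards v p k) \<le> k"
proof -
  have "card (guards v p k) \<le> card (p ` {1..k})"
    by (intro card_mono) (auto simp: guards_def)
  also have "\<dots> \<le> k"
    using card_image_le[of "{1..k}" p] by simp
  finally show ?thesis .
qed

text \<open>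
  Outward neighbours of the front that do not burn in time are newly counted guards, since those of
  the previous turn lie on smaller spheres. The set \<open>Y\<close> localises this to a quadrant.
\<close>

lemma card_front_step:
  "card (outward v k (front v p k) \<inter> Y) + card (guards v p k)
     \<le> card (front v p (Suc k) \<inter> Y) + card (guards v p (Suc k))"
proof -
  let ?N = "outward v k (front v p k) \<inter> Y" and ?P = "p ` {1..Suc k}"
  have fin: "finite ?N"
    by (simp add: finite_outward)
  have "?N - ?P \<subseteq> front v p (Suc k) \<inter> Y"
    by (auto simp: front_def outward_def)
  then have 1: "card (?N - ?P) \<le> card (front v p (Suc k) \<inter> Y)"
    by (intro card_mono) (auto simp: finite_front)
  have "(?N \<inter> ?P) \<union> guards v p k \<subseteq> guards v p (Suc k)"
    by (auto simp: guards_def outward_def)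
  then have "card ((?N \<inter> ?P) \<union> guards v p k) \<le> card (guards v p (Suc k))"
    by (intro card_mono) (auto simp: guards_def)
  moreover have "(?N \<inter> ?P) \<inter> guards v p k = {}"
    by (auto simp: guards_def outward_def)
  then have "card ((?N \<inter> ?P) \<union> guards v p k) = card (?N \<inter> ?P) + card (guards v p k)"
    by (intro card_Un_disjoint) (auto simp: guards_def)
  moreover have "card ?N = card (?N - ?P) + card (?N \<inter> ?P)"
    using fin by (subst card_Int_Diff[of _ ?P]) auto
  ultimately show ?thesis
    using 1 by linarith
qed

text \<open>
  The path in a closed quadrant grows from \<open>1\<close> to \<open>k + 1\<close> vertices while at most \<open>k\<close> vertices are protected, so
  the front in a quadrant can never be extinguished.
\<close>

lemma front_quadrant:
  assumes "u \<in> dirs"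
  shows "k < card (front v p k \<inter> frame v u ` quadrant) + card (guards v p k)"
proof (induction k)
  case 0
  have "front v p 0 \<inter> frame v u ` quadrant = {v}"
    using frame_0[of v u] by (force simp: front_def l1_def quadrant_def)
  then show ?case
    by simp
next
  case (Suc k)
  then have "front v p k \<inter> frame v u ` quadrant \<noteq> {}"
    using card_guards[of v p k] by (metis add_0 card.empty linorder_not_less)
  then show ?case
    using outward_growth(1)[OF assms, of "front v p k" v k] Suc
      card_front_step[of v k p "frame v u ` quadrant"]
    by (auto simp: front_def)
qed

text \<open>Four vertices are gained on every sphere, and at most \<open>k\<close> guards stand in the way.\<close>

lemma card_front: "3 * k \<le> card (front v p k - {v})"
proof -
  have "4 * k \<le> card (front v p k - {v}) + card (guards v p k)"
  proof (induction k)
    case (Suc k)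
    have "front v p k \<inter> frame v u ` quadrant \<noteq> {}" if "u \<in> dirs" for u
      using card_guards[of v p k] front_quadrant[OF that, of k v p]
      by (metis add_0 card.empty linorder_not_less)
    then have "card (front v p k - {v}) + 4 \<le> card (outward v k (front v p k))"
      by (intro outward_growth_total) (auto simp: front_def)
    moreover have "front v p (Suc k) - {v} = front v p (Suc k)"
      by (auto simp: front_def l1_def)
    ultimately show ?case
      using Suc card_front_step[of v k p UNIV] by simp
  qed simp
  then show ?thesis
    using card_guards[of v p k] by linarith
qed

lemma card_saved_le: "card ({w. l1 v w \<le> i} \<inter> saved square_grid v p) \<le> \<Sum>{..i}"
proof -
  let ?B = "{w. l1 v w \<le> i}"
  let ?F = "\<Union>k\<in>{..i}. front v p k - {v}"
  have v: "v \<in> burning square_grid v p 0"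
    by simp
  have sub: "?B \<inter> saved square_grid v p \<subseteq> ?B - insert v ?F"
    using v unfolding saved_def front_def by blast
  have F: "insert v ?F \<subseteq> ?B"
    by (auto simp: front_def l1_def)
  have "3 * \<Sum>{..i} = (\<Sum>k\<le>i. 3 * k)"
    by (simp add: sum_distrib_left)
  also have "\<dots> \<le> (\<Sum>k\<le>i. card (front v p k - {v}))"
    by (intro sum_mono card_front)
  also have "\<dots> = card ?F"
    by (rule card_UN_disjoint[symmetric]) (auto simp: finite_front, auto simp: front_def)
  finally have "1 + 3 * \<Sum>{..i} \<le> card (insert v ?F)"
    by (subst card_insert_disjoint) (auto simp: finite_front)
  moreover have "card (?B \<inter> saved square_grid v p) \<le> card ?B - card (insert v ?F)"
    using card_mono[OF _ sub] finite_nbhd[of v i] card_Diff_subset[OF finite_subset[OF F] F] by simp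
  ultimately show ?thesis
    using card_ball[of v i] by linarith
qed

lemma strategy_rate_le: "strategy_rate square_grid v p \<le> ereal (1 / 4)"
  unfolding strategy_rate_def
proof (intro Liminf_le eventuallyI)
  fix i
  have "real (card (nbhd square_grid i v \<inter> saved square_grid v p)) / real (card (nbhd square_grid i v))
      \<le> real (\<Sum>{..i}) / real (1 + 4 * \<Sum>{..i})"
    unfolding nbhd_square_grid card_ball
    by (intro divide_right_mono of_nat_mono card_saved_le) (rule of_nat_0_le_iff)
  also have "\<dots> \<le> 1 / 4"
    by (simp add: field_simps del: of_nat_sum)
  finally show "ereal (real (card (nbhd square_grid i v \<inter> saved square_grid v p)) / real (card (nbhd square_grid i v)))
      \<le> ereal (1 / 4)"
    by simp
qed simp


section \<open>A strategy that saves a quarter\<close>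

text \<open>
  Even turns build the wall on the diagonal \<open>y = x\<close>, odd turns the wall on \<open>y = 1 - x\<close>. Together
  they are exactly the points of the sector that have a neighbour outside it.
\<close>

definition diagonal_strategy :: "int \<times> int \<Rightarrow> nat \<Rightarrow> int \<times> int" where
  "diagonal_strategy v t =
     (let k = int (t div 2) in if even t then (fst v + k, snd v + k) else (fst v + k + 1, snd v - k))"

lemma l1_diagonal_strategy: "l1 v (diagonal_strategy v t) = t"
  by (cases "even t") (auto elim!: evenE oddE simp: l1_def diagonal_strategy_def Let_def)

lemma l1_burning: "w \<in> burning square_grid v p t \<Longrightarrow> l1 v w \<le> t"
proof (induction t arbitrary: w)
  case 0
  then show ?case by (simp add: l1_def)
next
  case (Suc t)
  then consider "w \<in> burning square_grid v p t"
    | z where "z \<in> burning square_grid v p t" "(z, w) \<in> square_grid"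
    by auto
  then show ?case
  proof cases
    case 1
    then show ?thesis using Suc.IH[of w] by simp
  next
    case 2
    then show ?thesis
      using Suc.IH[of z] l1_triangle[of v w z] unfolding square_grid_iff by linarith
  qed
qed

lemma diagonal_strategy_in_strategies: "diagonal_strategy v \<in> strategies square_grid v"
proof -
  have "diagonal_strategy v (Suc t) \<notin> burning square_grid v (diagonal_strategy v) t" for t
    using l1_burning[of "diagonal_strategy v (Suc t)" v _ t] by (auto simp: l1_diagonal_strategy)
  then show ?thesis
    by (simp add: strategies_def)
qed

text \<open>
  A point at which the fire could enter the sector is on a wall, and it is protected in the turn
  equal to its distance from \<open>v\<close>. The distance is positive, so it is a real turn.
\<close>

lemma sector_boundary:
  assumes "w \<in> frame v (1, 0) ` sector" "z \<notin> frame v (1, 0) ` sector" "l1 z w = 1"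
  shows "w = diagonal_strategy v (l1 v w)" "0 < l1 v w"
proof -
  have mem: "q \<in> frame v (1, 0) ` sector \<longleftrightarrow> - (fst q - fst v) < snd q - snd v \<and> snd q - snd v \<le> fst q - fst v" for q
  proof -
    have "q = frame v (1, 0) (fst q - fst v, snd q - snd v)"
      by (simp add: frame_def)
    then have "q \<in> frame v (1, 0) ` sector \<longleftrightarrow> (fst q - fst v, snd q - snd v) \<in> sector"
      using inj_frame[of "(1, 0)" v] by (metis dirs_def inj_image_mem_iff insertI1)
    then show ?thesis
      by (simp add: sector_def)
  qed
  define x y where "x = fst w - fst v" and "y = snd w - snd v"
  have w: "w = (fst v + x, snd v + y)"
    by (simp add: x_def y_def)
  have xy: "- x < y" "y \<le> x"
    using assms(1) unfolding mem by (simp_all add: x_def y_def)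
  then show "0 < l1 v w"
    by (simp add: w l1_def)
  have "y = x \<or> y = 1 - x"
    using assms(2,3) xy unfolding mem l1_def w by auto
  then show "w = diagonal_strategy v (l1 v w)"
  proof
    assume "y = x"
    then have "l1 v w = 2 * nat x"
      using xy by (simp add: w l1_def)
    then show ?thesis
      using xy \<open>y = x\<close> unfolding diagonal_strategy_def by (simp add: w)
  next
    assume y: "y = 1 - x"
    then have "l1 v w = Suc (2 * nat (x - 1))"
      using xy by (simp add: w l1_def)
    then show ?thesis
      using xy y unfolding diagonal_strategy_def by (simp add: w)
  qed
qed

lemma sector_saved: "frame v (1, 0) ` sector \<subseteq> saved square_grid v (diagonal_strategy v)"
proof -
  have "w \<notin> burning square_grid v (diagonal_strategy v) t" if "w \<in> frame v (1, 0) ` sector" for t w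
    using that
  proof (induction t arbitrary: w)
    case 0
    then show ?case by (auto simp: frame_def prod_eq_iff sector_def)
  next
    case (Suc t)
    show ?case
    proof
      assume "w \<in> burning square_grid v (diagonal_strategy v) (Suc t)"
      then obtain z where z: "z \<in> burning square_grid v (diagonal_strategy v) t" "l1 z w = 1"
          and unprotected: "w \<notin> diagonal_strategy v ` {1..Suc t}"
        using Suc by (auto simp: square_grid_iff)
      have "z \<notin> frame v (1, 0) ` sector"
        using Suc z(1) by blast
      note w = sector_boundary[OF Suc.prems this z(2)]
      have "l1 v w \<le> Suc t"
        using l1_triangle[of v w z] l1_burning[OF z(1)] z(2) by linarith
      then have "l1 v w \<in> {1..Suc t}"
        using w(2) by simp
      then show False
        using w(1) unprotected by (metis image_eqI)
    qed
  qed
  then show ?thesis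
    unfolding saved_def by blast
qed

text \<open>Both the half-open quadrant and the sector contain a quarter of the ball without its centre, so
  the sector contains \<open>0 + 1 + \<dots> + i\<close> of its \<open>1 + 4 (0 + 1 + \<dots> + i)\<close> points.\<close>

lemma diagonal_strategy_rate: "ereal (1 / 4) \<le> strategy_rate square_grid v (diagonal_strategy v)"
proof -
  let ?S = "saved square_grid v (diagonal_strategy v)"
  have sector: "card ({w. l1 v w \<le> i} \<inter> frame v (1, 0) ` sector) = \<Sum>{..i}" for i
    using card_ball_fundamental[OF fundamental_sector, of "(1, 0)" v i]
    by (simp add: card_ball dirs_def)
  have sum: "real (\<Sum>{..i}) = real i * (real i + 1) / 2" for i
    by (induction i) (auto simp: field_simps)
  have "(\<lambda>i. real (\<Sum>{..i}) / real (1 + 4 * \<Sum>{..i})) \<longlonglongrightarrow> 1 / 4"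
    unfolding of_nat_add of_nat_mult sum by real_asymp
  then have "(\<lambda>i. ereal (real (\<Sum>{..i}) / real (1 + 4 * \<Sum>{..i}))) \<longlonglongrightarrow> ereal (1 / 4)"
    by simp
  then have "ereal (1 / 4) = liminf (\<lambda>i. ereal (real (\<Sum>{..i}) / real (1 + 4 * \<Sum>{..i})))"
    by (intro lim_imp_Liminf[symmetric]) auto
  also have "\<dots> \<le> strategy_rate square_grid v (diagonal_strategy v)"
    unfolding strategy_rate_def
  proof (intro Liminf_mono always_eventually allI)
    fix i
    have "\<Sum>{..i} \<le> card ({w. l1 v w \<le> i} \<inter> ?S)"
      unfolding sector[symmetric] using sector_saved[of v]
      by (intro card_mono finite_Int disjI1 finite_nbhd) blast
    then have "real (\<Sum>{..i}) / real (1 + 4 * \<Sum>{..i})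
        \<le> real (card (nbhd square_grid i v \<inter> ?S)) / real (card (nbhd square_grid i v))"
      unfolding nbhd_square_grid card_ball by (intro divide_right_mono of_nat_mono) (auto simp del: of_nat_sum of_nat_add)
    then show "ereal (real (\<Sum>{..i}) / real (1 + 4 * \<Sum>{..i}))
        \<le> ereal (real (card (nbhd square_grid i v \<inter> ?S)) / real (card (nbhd square_grid i v)))"
      by simp
  qed
  finally show ?thesis .
qed

theorem theorem10:
  fixes v :: "int \<times> int"
  shows "surviving_rate square_grid v = ereal (1 / 4)"
  unfolding surviving_rate_def
proof (rule antisym)
  show "(SUP p\<in>strategies square_grid v. strategy_rate square_grid v p) \<le> ereal (1 / 4)"
    by (intro SUP_least strategy_rate_le)
  show "ereal (1 / 4) \<le> (SUP p\<in>strategies square_grid v. strategy_rate square_grid v p)"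
    by (rule order_trans[OF diagonal_strategy_rate
          SUP_upper[OF diagonal_strategy_in_strategies, where f = "strategy_rate square_grid v"]])
qed

end
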